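(* Let $n\ge 1$, let $B_k\in\mathbb{R}^{n\times n}$ be symmetric positive definite, and let $y_k,s_k\in\mathbb{R}^n$ satisfy $y_k^Ts_k>0$. Put $P_k=I_n-\frac{y_ky_k^T}{y_k^Ty_k}$. Then a solution $B^*$ of $$\min_{\{B=B^T,\;B>0\}}\ \mathbb{D}\left(B^{-1}\,\|\,P_k^TB_k^{-1}P_k\right)\quad\text{subject to}\quad B^{-1}y_k=s_k,$$ in the regularized sense defined in the context, is the symmetric positive definite matrix given by $$(B^* )^{-1}=\left(I_n-\frac{y_ky_k^T}{y_k^Ty_k}\right)B_k^{-1}\left(I_n-\frac{y_ky_k^T}{y_k^Ty_k}\right)+\frac{s_ks_k^T}{y_k^Ts_k}.$$
   Context: For symmetric positive definite $n\times n$ real matrices $P,Q$, the relative entropy between the zero-mean Gaussian distributions with covariances $P$ and $Q$ is written in terms of the inverse matrices as $$\mathbb{D}(P^{-1}\|Q^{-1})=\frac12\left[\log\det(P^{-1}Q)+\operatorname{trace}(Q^{-1}P)-n\right].$$ Here $B>0$ means that $B$ is positive definite. Regularized sense: since $P_k$ is singular, $\mathbb{D}(B^{-1}\|P_k^TB_k^{-1}P_k)$ is not defined. For $\epsilon>0$ set $P_k^\epsilon=P_k+\epsilon I_n$, which is symmetric positive definite. The regularized problem is to minimize $$\mathbb{D}\left(B^{-1}\,\|\,P_k^\epsilon B_k^{-1}P_k^\epsilon\right)=\frac12\left[\log\det\left(B^{-1}(P_k^\epsilon)^{-1}B_k(P_k^\epsilon)^{-1}\right)+\operatorname{trace}\left(P_k^\epsilon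 B_k^{-1}P_k^\epsilon B\right)-n\right]$$ over symmetric positive definite $B$ with $B^{-1}y_k=s_k$. A symmetric positive definite matrix $B^*$ with $(B^* )^{-1}y_k=s_k$ is a solution of the original problem in the regularized sense if, for every $\epsilon>0$, the regularized problem has a minimizer $B^\epsilon$, and these satisfy $(B^\epsilon)^{-1}\to(B^* )^{-1}$ as $\epsilon\searrow 0$. *)

theory Defs
  imports "HOL-Analysis.Analysis"
begin

definition spd :: "real ^ 'n ^ 'n \<Rightarrow> bool" where
  "spd A \<longleftrightarrow> transpose A = A \<and> (\<forall>x. x \<noteq> 0 \<longrightarrow> 0 < x \<bullet> (A *v x))"

definition outer :: "real ^ 'n \<Rightarrow> real ^ 'n \<Rightarrow> real ^ 'n ^ 'n" where
  "outer u v = (\<chi> i j. u $ i * v $ j)"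

text \<open>The relative entropy between zero-mean Gaussians with covariances \<open>P\<close> and \<open>Q\<close>, as
  a function of the inverse covariances \<open>X = P\<inverse>\<close> and \<open>Y = Q\<inverse>\<close>.\<close>

definition rel_entropy :: "real ^ 'n ^ 'n \<Rightarrow> real ^ 'n ^ 'n \<Rightarrow> real" where
  "rel_entropy X Y =
     (ln (det (X ** matrix_inv Y)) + trace (Y ** matrix_inv X) - real CARD('n)) / 2"

definition perp_proj :: "real ^ 'n \<Rightarrow> real ^ 'n ^ 'n" where
  "perp_proj y = mat 1 - (1 / (y \<bullet> y)) *\<^sub>R outer y y"

definition perp_proj_reg :: "real \<Rightarrow> real ^ 'n \<Rightarrow> real ^ 'n ^ 'n" where
  "perp_proj_reg \<epsilon> y = perp_proj y + \<epsilon> *\<^sub>R mat 1"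

definition feasible :: "real ^ 'n \<Rightarrow> real ^ 'n \<Rightarrow> real ^ 'n ^ 'n \<Rightarrow> bool" where
  "feasible y s B \<longleftrightarrow> spd B \<and> matrix_inv B *v y = s"

definition regularized_minimizer ::
  "real \<Rightarrow> real ^ 'n ^ 'n \<Rightarrow> real ^ 'n \<Rightarrow> real ^ 'n \<Rightarrow> real ^ 'n ^ 'n \<Rightarrow> bool" where
  "regularized_minimizer \<epsilon> Bk y s B \<longleftrightarrow>
     is_arg_min
       (\<lambda>B. rel_entropy (matrix_inv B)
              (perp_proj_reg \<epsilon> y ** matrix_inv Bk ** perp_proj_reg \<epsilon> y))
       (feasible y s) B"

definition regularized_solution ::
  "real ^ 'n ^ 'n \<Rightarrow> real ^ 'n \<Rightarrow> real ^ 'n \<Rightarrow> real ^ 'n ^ 'n \<Rightarrow> bool" where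
  "regularized_solution Bk y s B \<longleftrightarrow>
     feasible y s B \<and>
     (\<exists>Br. (\<forall>\<epsilon>>0. regularized_minimizer \<epsilon> Bk y s (Br \<epsilon>)) \<and>
           ((\<lambda>\<epsilon>. matrix_inv (Br \<epsilon>)) \<longlongrightarrow> matrix_inv B) (at_right 0))"

end

theory Submission
  imports Defs
begin

text \<open>Write \<open>Y = P\<^sub>\<epsilon> B\<^sub>k\<inverse> P\<^sub>\<epsilon>\<close>. Up to constants the objective is \<open>trace (Y B) - ln det B\<close>, and
  the constraint is the linear condition \<open>B s = y\<close>. Stationarity suggests \<open>B\<inverse> = H\<close> with
  \<open>Y = H + l s\<^sup>T + s l\<^sup>T\<close> for a multiplier \<open>l\<close> chosen so that \<open>H y = s\<close>. On the feasible set
  \<open>trace (Y B) = trace (H B) + 2 l \<bullet> y\<close>, so the objective is a constant plus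
  \<open>trace (H B) - ln det (H B)\<close>. The matrix \<open>H B\<close> is diagonalizable with positive eigenvalues, and
  \<open>ln d \<le> d - 1\<close> shows that \<open>B = H\<inverse>\<close> is the unique minimizer. Finally \<open>H\<close> is a polynomial in \<open>\<epsilon>\<close>
  whose value at \<open>0\<close> is the claimed matrix.\<close>

section \<open>Quadratic forms, Rayleigh quotients and generalized eigenvectors\<close>

lemma inner_transpose_mult:
  fixes A :: "real ^ 'n ^ 'm"
  shows "x \<bullet> (transpose A *v y) = (A *v x) \<bullet> y"
  by (metis dot_lmul_matrix inner_commute transpose_matrix_vector)

lemma symmetric_inner:
  fixes A :: "real ^ 'n ^ 'n"
  assumes "transpose A = A"
  shows "x \<bullet> (A *v y) = y \<bullet> (A *v x)"
  by (metis assms inner_commute inner_transpose_mult)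

text \<open>At a zero a nonnegative quadratic form is minimal, so its derivative vanishes there in
  every direction of \<open>S\<close>. Applied to a Rayleigh maximizer, this yields the eigenvector
  equation.\<close>

lemma quadratic_form_kernel:
  fixes K :: "real ^ 'n ^ 'n"
  assumes K: "transpose K = K" and S: "subspace S"
    and nonneg: "\<And>x. x \<in> S \<Longrightarrow> 0 \<le> x \<bullet> (K *v x)"
    and u: "u \<in> S" "u \<bullet> (K *v u) = 0" and w: "w \<in> S"
  shows "w \<bullet> (K *v u) = 0"
proof (rule ccontr)
  define b where "b = w \<bullet> (K *v u)"
  assume "w \<bullet> (K *v u) \<noteq> 0"
  then have b: "b \<noteq> 0" by (simp add: b_def)
  define c where "c = w \<bullet> (K *v w)"
  have c: "c \<ge> 0" using nonneg[OF w] by (simp add: c_def)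
  have q: "0 \<le> 2 * t * b + t\<^sup>2 * c" for t
  proof -
    have "u + t *\<^sub>R w \<in> S"
      using S u w by (simp add: subspace_add subspace_scale)
    then have "0 \<le> (u + t *\<^sub>R w) \<bullet> (K *v (u + t *\<^sub>R w))"
      by (rule nonneg)
    also have "\<dots> = 2 * t * b + t\<^sup>2 * c"
      using u(2) symmetric_inner[OF K, of u w]
      by (simp add: b_def c_def algebra_simps inner_add_left inner_add_right power2_eq_square)
    finally show ?thesis .
  qed
  \<comment> \<open>This choice turns the bound in \<open>q\<close> into
    \<open>- (t\<^sup>2 * (c + 2))\<close>; the denominator \<open>c + 1\<close> instead of
    \<open>c\<close> covers the case \<open>c = 0\<close>.\<close>
  define t where "t = - b / (c + 1)"
  have b': "b = - t * (c + 1)" using c by (simp add: t_def)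
  have "t\<^sup>2 * (c + 2) > 0"
    using b c by (simp add: t_def)
  moreover have "2 * t * b + t\<^sup>2 * c = - (t\<^sup>2 * (c + 2))"
    unfolding b' by (simp add: algebra_simps power2_eq_square)
  ultimately show False using q[of t] by linarith
qed

text \<open>The Rayleigh quotient is continuous on the compact unit sphere of \<open>S\<close> and
  invariant under scaling, so its maximum there bounds it on all of \<open>S\<close>. A final
  rescaling normalizes the maximizer with respect to \<open>N\<close>.\<close>

lemma rayleigh_maximizer:
  fixes M N :: "real ^ 'n ^ 'n"
  assumes N: "spd N" and S: "subspace S" and nz: "x0 \<in> S" "x0 \<noteq> 0"
  obtains u l where "u \<in> S" "u \<bullet> (N *v u) = 1" "u \<bullet> (M *v u) = l"
    "\<And>x. x \<in> S \<Longrightarrow> x \<bullet> (M *v x) \<le> l * (x \<bullet> (N *v x))"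
proof -
  define R where "R x = (x \<bullet> (M *v x)) / (x \<bullet> (N *v x))" for x
  have pos: "x \<noteq> 0 \<Longrightarrow> x \<bullet> (N *v x) > 0" for x using N by (auto simp: spd_def)
  define T where "T = S \<inter> sphere 0 1"
  have nonzero: "x \<bullet> (N *v x) \<noteq> 0" if "x \<in> T" for x
    using pos[of x] that by (cases "x = 0") (auto simp: T_def)
  have "compact T"
    unfolding T_def using closed_subspace[OF S] by (simp add: closed_Int_compact)
  moreover have "x0 /\<^sub>R norm x0 \<in> T"
    using S nz by (simp add: T_def subspace_scale)
  then have "T \<noteq> {}" by blast
  moreover have "continuous_on T R"
    unfolding R_def
    by (intro continuous_intros linear_continuous_on matrix_vector_mul_bounded_linear)
      (simp add: nonzero)
  ultimately obtain w where w: "w \<in> T" "\<And>x. x \<in> T \<Longrightarrow> R x \<le> R w"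
    using continuous_attains_sup[of T R] by blast
  have R_scale: "R (c *\<^sub>R x) = R x" if "c \<noteq> 0" for c x
    using that by (simp add: R_def algebra_simps)
  have le: "x \<bullet> (M *v x) \<le> R w * (x \<bullet> (N *v x))" if "x \<in> S" for x
  proof (cases "x = 0")
    case False
    then have "x /\<^sub>R norm x \<in> T" using S that by (simp add: T_def subspace_scale)
    then have "R x \<le> R w" using w(2) R_scale[of "inverse (norm x)" x] False by fastforce
    then show ?thesis using pos[OF False] by (simp add: R_def divide_le_eq)
  qed simp
  have "w \<noteq> 0" "w \<in> S" using w by (auto simp: T_def)
  define n where "n = w \<bullet> (N *v w)"
  have n: "n > 0" using pos \<open>w \<noteq> 0\<close> by (simp add: n_def)
  define u where "u = (1 / sqrt n) *\<^sub>R w"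
  have "u \<in> S" using S \<open>w \<in> S\<close> by (simp add: u_def subspace_scale)
  moreover have u1: "u \<bullet> (N *v u) = 1"
    using n by (simp add: u_def algebra_simps flip: n_def)
  moreover have "u \<bullet> (M *v u) = R w"
    using u1 R_scale[of "1 / sqrt n" w] n unfolding u_def[symmetric] by (simp add: R_def)
  ultimately show ?thesis using le that by blast
qed

text \<open>By induction on \<open>F\<close>, each new vector maximizes the Rayleigh quotient on the
  \<open>N\<close>-orthogonal complement of those already found. Taking \<open>F\<close> inside the
  coordinate index type leaves room for one more vector at each step, and \<open>F = UNIV\<close>
  gives a full basis.\<close>

lemma generalized_eigenvectors:
  fixes M N :: "real ^ 'n ^ 'n" and F :: "'n set"
  assumes M: "transpose M = M" and N: "spd N"
  shows "\<exists>v d. (\<forall>i\<in>F. \<forall>j\<in>F. v i \<bullet> (N *v v j) = (if i = j then 1 else 0)) \<and>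
           (\<forall>i\<in>F. M *v v i = d i *\<^sub>R (N *v v i))"
proof (induction F rule: finite_induct[OF finite])
  case 1
  show ?case by simp
next
  case (2 a F)
  then obtain v d where
    v: "\<And>i j. i \<in> F \<Longrightarrow> j \<in> F \<Longrightarrow> v i \<bullet> (N *v v j) = (if i = j then 1 else 0)"
    and d: "\<And>i. i \<in> F \<Longrightarrow> M *v v i = d i *\<^sub>R (N *v v i)"
    by metis
  have NT: "transpose N = N" using N by (simp add: spd_def)
  define S where "S = {x. \<forall>i\<in>F. x \<bullet> (N *v v i) = 0}"
  have S: "subspace S" by (auto simp: S_def subspace_def inner_add_left)
  \<comment> \<open>Since \<open>a\<close> lies outside \<open>F\<close>, there are fewer than n
    vectors \<open>N *v v i\<close>, so \<open>S\<close> contains a nonzero vector.\<close>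
  have "dim ((\<lambda>i. N *v v i) ` F) \<le> card ((\<lambda>i. N *v v i) ` F)"
    by (rule dim_le_card') (simp add: 2)
  also have "\<dots> \<le> card F" by (simp add: card_image_le)
  also have "\<dots> < CARD('n)"
    using 2 by (metis UNIV_I finite psubset_card_mono top.not_eq_extremum)
  finally have "dim ((\<lambda>i. N *v v i) ` F) < DIM(real ^ 'n)" by simp
  then obtain x0 where "x0 \<noteq> 0" "\<And>y. y \<in> span ((\<lambda>i. N *v v i) ` F) \<Longrightarrow> orthogonal x0 y"
    by (rule orthogonal_to_subspace_exists) blast
  then have "x0 \<in> S" by (auto simp: S_def orthogonal_def span_base)
  from rayleigh_maximizer[OF N S this \<open>x0 \<noteq> 0\<close>, of M] obtain u l where
    u: "u \<in> S" "u \<bullet> (N *v u) = 1" "u \<bullet> (M *v u) = l"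
    and le: "\<And>x. x \<in> S \<Longrightarrow> x \<bullet> (M *v x) \<le> l * (x \<bullet> (N *v x))" by blast
  \<comment> \<open>Maximality of \<open>l\<close> makes the form of \<open>K\<close> nonnegative on
    \<open>S\<close> with a zero at \<open>u\<close>, so \<open>K *v u\<close> is orthogonal to
    \<open>S\<close>. Orthogonality to the \<open>v i\<close> comes from their own eigenvector
    equations.\<close>
  define K where "K = l *\<^sub>R N - M"
  have Kv: "K *v x = l *\<^sub>R (N *v x) - M *v x" for x
    by (simp add: K_def algebra_simps scaleR_matrix_vector_assoc)
  have KT: "transpose K = K"
    using M NT by (auto simp: K_def transpose_def vec_eq_iff)
  have KS: "w \<bullet> (K *v u) = 0" if "w \<in> S" for w
    by (rule quadratic_form_kernel[OF KT S _ u(1) _ that])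
      (use le u in \<open>auto simp: Kv inner_diff_right\<close>)
  have KF: "v i \<bullet> (K *v u) = 0" if "i \<in> F" for i
  proof -
    have "v i \<bullet> (K *v u) = u \<bullet> (K *v v i)" by (rule symmetric_inner[OF KT])
    also have "\<dots> = 0" using u(1) that by (simp add: Kv d S_def inner_diff_right)
    finally show ?thesis .
  qed
  have "x \<bullet> (K *v u) = 0" for x
  proof -
    \<comment> \<open>The \<open>N\<close>-orthogonal projection of \<open>x\<close> onto the span
      of the \<open>v i\<close>: the remainder \<open>x - p\<close> is covered by \<open>KS\<close>,
      and \<open>p\<close> itself by \<open>KF\<close>.\<close>
    define p where "p = (\<Sum>i\<in>F. (x \<bullet> (N *v v i)) *\<^sub>R v i)"
    have "x - p \<in> S"
      using 2(1) by (simp add: S_def p_def inner_diff_left inner_sum_left v if_distrib cong: if_cong)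
    moreover have "p \<bullet> (K *v u) = 0" by (simp add: p_def inner_sum_left KF)
    ultimately show ?thesis using KS[of "x - p"] by (simp add: inner_diff_left)
  qed
  then have "K *v u = 0" using inner_eq_zero_iff by blast
  then have Mu: "M *v u = l *\<^sub>R (N *v u)" by (simp add: Kv)
  have uv: "u \<bullet> (N *v v i) = 0" "v i \<bullet> (N *v u) = 0" if "i \<in> F" for i
    using u(1) that symmetric_inner[OF NT, of u "v i"] by (auto simp: S_def)
  show ?case
    by (rule exI[of _ "v(a := u)"], rule exI[of _ "d(a := l)"])
      (use 2 v d u uv Mu in auto)
qed

section \<open>Inverses and products of positive definite matrices\<close>

lemma matrix_inv_unique:
  fixes A B :: "real ^ 'n ^ 'n"
  assumes "A ** B = mat 1"
  shows "matrix_inv A = B"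
proof -
  have "B ** A = mat 1" using assms matrix_left_right_inverse by blast
  then have "A ** matrix_inv A = mat 1 \<and> matrix_inv A ** A = mat 1"
    unfolding matrix_inv_def using assms by (metis (mono_tags, lifting) someI_ex)
  then show ?thesis
    by (metis \<open>B ** A = mat 1\<close> matrix_mul_assoc matrix_mul_lid matrix_mul_rid)
qed

lemma spd_matrix_inv:
  fixes A :: "real ^ 'n ^ 'n"
  assumes A: "spd A"
  shows "A ** matrix_inv A = mat 1" "matrix_inv A ** A = mat 1"
    "matrix_inv (matrix_inv A) = A" "spd (matrix_inv A)"
proof -
  have "x = 0" if "A *v x = 0" for x
    using A that by (force simp: spd_def)
  then obtain B where B: "B ** A = mat 1"
    using matrix_left_invertible_ker by blast
  then have B': "A ** B = mat 1" using matrix_left_right_inverse by blast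
  then have inv: "matrix_inv A = B" by (rule matrix_inv_unique)
  show "A ** matrix_inv A = mat 1" "matrix_inv A ** A = mat 1"
    using B B' inv by simp_all
  show "matrix_inv (matrix_inv A) = A"
    unfolding inv using B by (rule matrix_inv_unique)
  have AT: "transpose A = A" using A by (simp add: spd_def)
  have BT: "transpose B = B"
  proof -
    have "A ** transpose B = mat 1"
      by (metis AT B matrix_transpose_mul transpose_mat)
    then show ?thesis
      using matrix_inv_unique inv by metis
  qed
  show "spd (matrix_inv A)"
    unfolding inv spd_def
  proof (intro conjI allI impI)
    fix x :: "real ^ 'n" assume "x \<noteq> 0"
    have x: "A *v (B *v x) = x" by (simp add: matrix_vector_mul_assoc B')
    then have "B *v x \<noteq> 0" using \<open>x \<noteq> 0\<close> by auto
    then have "0 < (B *v x) \<bullet> (A *v (B *v x))" using A by (simp add: spd_def)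
    then show "0 < x \<bullet> (B *v x)" by (simp add: x inner_commute)
  qed (rule BT)
qed

text \<open>The product \<open>H ** B\<close> need not be symmetric, but with \<open>N\<close> the
  inverse of \<open>H\<close> its eigenvector equation becomes \<open>B v = d N v\<close>, a problem
  for a symmetric pair. Normalization gives \<open>d i\<close> as the value of the form of
  \<open>B\<close> at \<open>v i\<close>, hence positive.\<close>

lemma spd_mult_diagonalizable:
  fixes H B :: "real ^ 'n ^ 'n"
  assumes H: "spd H" and B: "spd B"
  obtains V W :: "real ^ 'n ^ 'n" and d where "V ** W = mat 1" "\<And>i. 0 < d i"
    "H ** B = V ** (\<chi> i j. if i = j then d i else 0) ** W"
proof -
  define N where "N = matrix_inv H"
  have N: "spd N" "H ** N = mat 1" using spd_matrix_inv[OF H] by (simp_all add: N_def)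
  have "transpose B = B" using B by (simp add: spd_def)
  from generalized_eigenvectors[OF this N(1), of UNIV] obtain v :: "'n \<Rightarrow> real ^ 'n" and d where
    "\<forall>i\<in>UNIV. \<forall>j\<in>UNIV. v i \<bullet> (N *v v j) = (if i = j then 1 else 0)"
    "\<forall>i\<in>UNIV. B *v v i = d i *\<^sub>R (N *v v i)"
    by blast
  then have v: "\<And>i j. v i \<bullet> (N *v v j) = (if i = j then 1 else 0)"
    and d: "\<And>i. B *v v i = d i *\<^sub>R (N *v v i)"
    by auto
  define V where "V = (\<chi> i j. v j $ i)"
  define D :: "real ^ 'n ^ 'n" where "D = (\<chi> i j. if i = j then d i else 0)"
  \<comment> \<open>\<open>N\<close>-orthonormality of the columns of \<open>V\<close> says exactly
    that this is the inverse of \<open>V\<close>.\<close>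
  define W where "W = transpose V ** N"
  have col: "(A ** V) $ i $ j = (A *v v j) $ i" for A :: "real ^ 'n ^ 'n" and i j
    by (simp add: V_def matrix_matrix_mult_def matrix_vector_mult_def)
  have "(transpose V ** (N ** V)) $ i $ j = v i \<bullet> (N *v v j)" for i j
  proof -
    have "(transpose V ** (N ** V)) $ i $ j = (\<Sum>k\<in>UNIV. transpose V $ i $ k * (N ** V) $ k $ j)"
      by (simp add: matrix_matrix_mult_def)
    then show ?thesis
      unfolding col by (simp add: transpose_def V_def inner_vec_def)
  qed
  then have "W ** V = mat 1"
    by (simp add: W_def v vec_eq_iff mat_def flip: matrix_mul_assoc)
  then have VW: "V ** W = mat 1" using matrix_left_right_inverse by blast
  have "(V ** D) $ i $ j = d j * v j $ i" for i j
    by (simp add: V_def D_def matrix_matrix_mult_def if_distrib cong: if_cong)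
  moreover have "((H ** B) ** V) $ i $ j = d j * v j $ i" for i j
  proof -
    have "(H ** B) *v v j = d j *\<^sub>R v j"
      by (simp add: d N(2) matrix_vector_mult_scaleR matrix_vector_mul_assoc flip: matrix_vector_mul_assoc[of H B])
    then show ?thesis by (simp add: col)
  qed
  ultimately have "(H ** B) ** V = V ** D" by (simp add: vec_eq_iff)
  then have "H ** B = V ** D ** W"
    by (metis VW matrix_mul_assoc matrix_mul_rid)
  moreover have "d i > 0" for i
  proof -
    have "v i \<noteq> 0" using v[of i i] by auto
    then have "0 < v i \<bullet> (B *v v i)" using B by (simp add: spd_def)
    then show ?thesis by (simp add: d v)
  qed
  ultimately show ?thesis using that VW unfolding D_def by blast
qed

text \<open>Determinant and trace are the product and the sum of the eigenvalues \<open>d i\<close>,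
  which reduces everything to \<open>ln d \<le> d - 1\<close>. Equality of the sums forces equality
  in each term, hence all \<open>d i = 1\<close>; this gives uniqueness of the minimizer.\<close>

lemma ln_det_spd_mult:
  fixes H B :: "real ^ 'n ^ 'n"
  assumes "spd H" and "spd B"
  shows "0 < det (H ** B)"
    and "ln (det (H ** B)) \<le> trace (H ** B) - real CARD('n)"
    and "ln (det (H ** B)) = trace (H ** B) - real CARD('n) \<Longrightarrow> H ** B = mat 1"
proof -
  obtain V W :: "real ^ 'n ^ 'n" and d where VW: "V ** W = mat 1" and d: "\<And>i. 0 < d i"
    and HB: "H ** B = V ** (\<chi> i j. if i = j then d i else 0) ** W"
    by (rule spd_mult_diagonalizable[OF assms]) blast
  define D :: "real ^ 'n ^ 'n" where "D = (\<chi> i j. if i = j then d i else 0)"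
  have HB: "H ** B = V ** D ** W" using HB by (simp add: D_def)
  have WV: "W ** V = mat 1" using VW matrix_left_right_inverse by blast
  have "det V * det W = 1" by (metis VW det_I det_mul)
  then have "det (H ** B) = det D" by (simp add: HB det_mul)
  also have "\<dots> = (\<Prod>i\<in>UNIV. d i)"
    by (subst det_diagonal) (simp_all add: D_def)
  finally have det: "det (H ** B) = (\<Prod>i\<in>UNIV. d i)" .
  then show "0 < det (H ** B)" by (simp add: d prod_pos)
  have ln: "ln (det (H ** B)) = (\<Sum>i\<in>UNIV. ln (d i))"
    unfolding det by (rule ln_prod) (use d in \<open>simp_all add: less_imp_neq[THEN not_sym]\<close>)
  have "trace (H ** B) = trace (W ** (V ** D))"
    unfolding HB by (rule trace_mul_sym)
  also have "\<dots> = trace D" by (simp add: matrix_mul_assoc WV)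
  also have "\<dots> = (\<Sum>i\<in>UNIV. d i)" by (simp add: trace_def D_def)
  finally have tr: "trace (H ** B) - real CARD('n) = (\<Sum>i\<in>UNIV. d i - 1)"
    by (simp add: sum_subtractf)
  show "ln (det (H ** B)) \<le> trace (H ** B) - real CARD('n)"
    unfolding ln tr by (intro sum_mono ln_le_minus_one d)
  assume "ln (det (H ** B)) = trace (H ** B) - real CARD('n)"
  then have "(\<Sum>i\<in>UNIV. d i - 1 - ln (d i)) = 0"
    unfolding ln tr by (simp add: sum_subtractf)
  then have "d i - 1 - ln (d i) = 0" for i
    by (subst (asm) sum_nonneg_eq_0_iff) (simp_all add: d ln_le_minus_one)
  then have "d i = 1" for i using ln_eq_minus_one[OF d, of i] by simp
  then have "D = mat 1" by (simp add: D_def mat_def vec_eq_iff)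
  then show "H ** B = mat 1" using HB VW by simp
qed

lemma det_spd_pos:
  fixes A :: "real ^ 'n ^ 'n"
  assumes "spd A"
  shows "0 < det A"
proof -
  have "spd (mat 1 :: real ^ 'n ^ 'n)" by (simp add: spd_def)
  from ln_det_spd_mult(1)[OF this assms] show ?thesis by simp
qed

section \<open>Rank-one matrices\<close>

lemma outer_mult_vec: "outer u v *v x = (v \<bullet> x) *\<^sub>R u"
  by (simp add: outer_def matrix_vector_mult_def vec_eq_iff inner_vec_def sum_distrib_right
      sum_distrib_left mult_ac)

lemma matrix_mult_outer: "A ** outer u v = outer (A *v u) v"
  by (simp add: outer_def matrix_vector_mult_def matrix_matrix_mult_def vec_eq_iff
      sum_distrib_right sum_distrib_left mult_ac)

lemma transpose_outer: "transpose (outer u v) = outer v u"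
  by (simp add: outer_def transpose_def vec_eq_iff mult_ac)

lemma trace_outer: "trace (outer u v) = u \<bullet> v"
  by (simp add: outer_def trace_def inner_vec_def)

lemma matrix_add_rdistrib: "(A + B) ** C = A ** C + B ** (C :: real ^ 'k ^ 'n)"
  by (simp add: matrix_matrix_mult_def vec_eq_iff sum.distrib distrib_right)

lemma transpose_add: "transpose (A + B) = transpose A + transpose (B :: real ^ 'n ^ 'm)"
  by (simp add: transpose_def vec_eq_iff)

lemma transpose_diff: "transpose (A - B) = transpose A - transpose (B :: real ^ 'n ^ 'm)"
  by (simp add: transpose_def vec_eq_iff)

section \<open>The regularized projector and the BFGS update\<close>

lemma perp_proj_reg_mult_vec:
  "perp_proj_reg e y *v x = (1 + e) *\<^sub>R x - ((y \<bullet> x) / (y \<bullet> y)) *\<^sub>R y"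
  by (simp add: perp_proj_reg_def perp_proj_def algebra_simps outer_mult_vec
      flip: scaleR_matrix_vector_assoc)

lemma transpose_perp_proj_reg: "transpose (perp_proj_reg e y) = perp_proj_reg e y"
  by (simp add: perp_proj_reg_def perp_proj_def transpose_add transpose_diff transpose_scalar
      transpose_outer)

text \<open>\<open>update_root\<close> is \<open>P\<^sub>\<epsilon> (I - y s\<^sup>T / y\<^sup>T s)\<close>, simplified using \<open>P\<^sub>\<epsilon> y = \<epsilon> y\<close>; hence
  \<open>secant_update\<close> is the BFGS update of \<open>P\<^sub>\<epsilon> H P\<^sub>\<epsilon>\<close> for the secant pair \<open>(s, y)\<close>.\<close>

definition update_root :: "real \<Rightarrow> real ^ 'n \<Rightarrow> real ^ 'n \<Rightarrow> real ^ 'n ^ 'n" where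
  "update_root e y s = perp_proj_reg e y - (e / (y \<bullet> s)) *\<^sub>R outer y s"

definition secant_update ::
  "real \<Rightarrow> real ^ 'n ^ 'n \<Rightarrow> real ^ 'n \<Rightarrow> real ^ 'n \<Rightarrow> real ^ 'n ^ 'n" where
  "secant_update e H y s =
     transpose (update_root e y s) ** H ** update_root e y s + (1 / (y \<bullet> s)) *\<^sub>R outer s s"

lemma update_root_mult_vec:
  "update_root e y s *v x = perp_proj_reg e y *v x - (e * (s \<bullet> x) / (y \<bullet> s)) *\<^sub>R y"
  by (simp add: update_root_def algebra_simps outer_mult_vec flip: scaleR_matrix_vector_assoc)

lemma secant_update_mult_vec:
  "secant_update e H y s *v x =
     transpose (update_root e y s) *v (H *v (update_root e y s *v x)) + ((s \<bullet> x) / (y \<bullet> s)) *\<^sub>R s"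
  by (simp add: secant_update_def matrix_vector_mult_add_rdistrib outer_mult_vec
      flip: scaleR_matrix_vector_assoc matrix_vector_mul_assoc del: transpose_matrix_vector)

text \<open>The correction in \<open>update_root\<close> is scaled to annihilate \<open>y\<close>,
  so only the rank-one term acts on \<open>y\<close>.\<close>

lemma secant_update_mult_y:
  assumes "y \<bullet> s > 0"
  shows "secant_update e H y s *v y = s"
proof -
  have "y \<bullet> y \<noteq> 0" using assms by auto
  then have "update_root e y s *v y = 0"
    using assms by (simp add: update_root_mult_vec perp_proj_reg_mult_vec inner_commute algebra_simps)
  then show ?thesis
    using assms by (simp add: secant_update_mult_vec inner_commute)
qed

text \<open>Both summands have nonnegative forms, and they share no nonzero zero. The case
  \<open>e = 0\<close> is included because it is the limit matrix.\<close>

lemma spd_secant_update: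
  assumes H: "spd H" and ys: "y \<bullet> s > 0" and e: "e \<ge> 0"
  shows "spd (secant_update e H y s)"
  unfolding spd_def
proof (intro conjI allI impI)
  have "transpose H = H" using H by (simp add: spd_def)
  then show "transpose (secant_update e H y s) = secant_update e H y s"
    by (simp add: secant_update_def transpose_add transpose_scalar transpose_outer
        matrix_transpose_mul matrix_mul_assoc)
next
  fix x :: "real ^ 'a" assume "x \<noteq> 0"
  define C where "C = update_root e y s"
  have eq: "x \<bullet> (secant_update e H y s *v x) = (C *v x) \<bullet> (H *v (C *v x)) + (s \<bullet> x)\<^sup>2 / (y \<bullet> s)"
    by (simp add: secant_update_mult_vec C_def inner_add_right inner_transpose_mult
        power2_eq_square inner_commute del: transpose_matrix_vector)
  show "0 < x \<bullet> (secant_update e H y s *v x)"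
  proof (cases "s \<bullet> x = 0")
    case False
    moreover have "0 \<le> (C *v x) \<bullet> (H *v (C *v x))"
      using H by (cases "C *v x = 0") (auto simp: spd_def less_imp_le)
    ultimately show ?thesis unfolding eq using ys by (simp add: add_nonneg_pos)
  next
    case True
    \<comment> \<open>When \<open>s \<bullet> x = 0\<close> the correction drops out, so
      \<open>C *v x = 0\<close> would make \<open>x\<close> a multiple of \<open>y\<close>; pairing
      with \<open>s\<close> shows that the multiple is zero.\<close>
    have "C *v x \<noteq> 0"
    proof
      assume "C *v x = 0"
      then have *: "(1 + e) *\<^sub>R x = ((y \<bullet> x) / (y \<bullet> y)) *\<^sub>R y"
        by (simp add: C_def update_root_mult_vec perp_proj_reg_mult_vec True)
      then have "s \<bullet> ((1 + e) *\<^sub>R x) = s \<bullet> (((y \<bullet> x) / (y \<bullet> y)) *\<^sub>R y)" by simp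
      then have "y \<bullet> x = 0 \<or> y \<bullet> y = 0" using ys by (simp add: True inner_commute)
      with * have "(1 + e) *\<^sub>R x = 0" by auto
      with e \<open>x \<noteq> 0\<close> show False by simp
    qed
    then show ?thesis using H by (simp add: eq True spd_def)
  qed
qed

section \<open>The multiplier identity and the regularized minimizer\<close>

lemma trace_multiplier_term:
  assumes "transpose B = B" and "B *v s = y"
  shows "trace ((outer l s + outer s l) ** B) = 2 * (l \<bullet> y)"
proof -
  have "trace (outer l s ** B) = l \<bullet> y" "trace (outer s l ** B) = l \<bullet> y"
    using assms symmetric_inner[of B s l]
    by (simp_all add: trace_mul_sym[of _ B] matrix_mult_outer trace_outer inner_commute)
  then show ?thesis by (simp add: matrix_add_rdistrib trace_add)
qed

text \<open>Substituting \<open>C + a *\<^sub>R outer y s\<close> for the regularized projector,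
  with \<open>C\<close> the update root, leaves only terms having \<open>s\<close> as a row or
  column factor besides the conjugate of \<open>H\<close> by \<open>C\<close>. The identity is
  checked as one of bilinear forms.\<close>

lemma perp_proj_reg_conj_eq:
  fixes H :: "real ^ 'n ^ 'n"
  assumes H: "transpose H = H" and ys: "y \<bullet> s > 0"
  shows "\<exists>l. perp_proj_reg e y ** H ** perp_proj_reg e y = secant_update e H y s + (outer l s + outer s l)"
proof -
  define C where "C = update_root e y s"
  define a where "a = e / (y \<bullet> s)"
  \<comment> \<open>The first summand absorbs the cross terms. The total coefficient of
    \<open>outer s s\<close> is halved because both outer products contribute to it.\<close>
  define l where "l = a *\<^sub>R (transpose C *v (H *v y)) + ((a\<^sup>2 * (y \<bullet> (H *v y)) - 1 / (y \<bullet> s)) / 2) *\<^sub>R s"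
  have P: "perp_proj_reg e y *v x = C *v x + (a * (s \<bullet> x)) *\<^sub>R y" for x
    by (simp add: C_def a_def update_root_mult_vec)
  have "x \<bullet> ((perp_proj_reg e y ** H ** perp_proj_reg e y) *v z) =
        x \<bullet> ((secant_update e H y s + (outer l s + outer s l)) *v z)" for x z
  proof -
    have "x \<bullet> ((perp_proj_reg e y ** H ** perp_proj_reg e y) *v z) =
          (perp_proj_reg e y *v x) \<bullet> (H *v (perp_proj_reg e y *v z))"
      by (metis inner_transpose_mult matrix_vector_mul_assoc transpose_perp_proj_reg)
    also have "\<dots> = (C *v x) \<bullet> (H *v (C *v z)) + a * (s \<bullet> z) * ((C *v x) \<bullet> (H *v y))
        + a * (s \<bullet> x) * ((C *v z) \<bullet> (H *v y)) + a\<^sup>2 * (s \<bullet> x) * (s \<bullet> z) * (y \<bullet> (H *v y))"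
      using symmetric_inner[OF H, of y "C *v z"]
      by (simp add: P algebra_simps inner_add_left inner_add_right power2_eq_square)
    also have "\<dots> = x \<bullet> ((secant_update e H y s + (outer l s + outer s l)) *v z)"
    proof -
      have lx: "l \<bullet> x = a * ((C *v x) \<bullet> (H *v y)) + ((a\<^sup>2 * (y \<bullet> (H *v y)) - 1 / (y \<bullet> s)) / 2) * (s \<bullet> x)" for x
        by (simp add: l_def inner_commute[of _ x] inner_add_right inner_transpose_mult
            del: transpose_matrix_vector)
      have "x \<bullet> ((secant_update e H y s + (outer l s + outer s l)) *v z) =
          (C *v x) \<bullet> (H *v (C *v z)) + (s \<bullet> z) / (y \<bullet> s) * (s \<bullet> x) + (s \<bullet> z) * (l \<bullet> x) + (l \<bullet> z) * (s \<bullet> x)"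
        by (simp add: matrix_vector_mult_add_rdistrib secant_update_mult_vec C_def outer_mult_vec
            inner_add_right inner_transpose_mult inner_commute[of x s] inner_commute[of x l]
            del: transpose_matrix_vector)
      then show ?thesis unfolding lx by (simp add: algebra_simps)
    qed
    finally show ?thesis .
  qed
  then have "perp_proj_reg e y ** H ** perp_proj_reg e y =
      secant_update e H y s + (outer l s + outer s l)"
    unfolding matrix_eq by (metis vector_eq_rdot inner_commute)
  then show ?thesis ..
qed

text \<open>The auxiliary \<open>H\<close> cancels; it is inserted so that the objective contains
  the logarithm bounded in \<open>ln_det_spd_mult\<close>.\<close>

lemma rel_entropy_eq:
  fixes X Y B :: "real ^ 'n ^ 'n"
  assumes "spd H" "spd Y" "spd B"
  shows "rel_entropy (matrix_inv B) Y =
     (trace (Y ** B) - ln (det (H ** B)) + ln (det H) - ln (det Y) - real CARD('n)) / 2"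
proof -
  have inv: "det A * det (matrix_inv A) = 1" if "spd A" for A :: "real ^ 'n ^ 'n"
    by (metis that spd_matrix_inv(1) det_I det_mul)
  have ln_inv: "ln (det (matrix_inv A)) = - ln (det A)" if "spd A" for A :: "real ^ 'n ^ 'n"
    using inv[OF that] det_spd_pos[OF that]
    by (metis inverse_unique ln_inverse)
  show ?thesis
    using det_spd_pos[OF assms(1)] det_spd_pos[OF assms(3)]
      det_spd_pos[OF spd_matrix_inv(4)[OF assms(2)]] det_spd_pos[OF spd_matrix_inv(4)[OF assms(3)]]
    by (simp add: rel_entropy_def det_mul ln_mult ln_inv assms spd_matrix_inv(3))
qed

text \<open>It suffices that the regularized projector is injective. Pairing a kernel vector
  \<open>x\<close> with a nonzero \<open>y\<close> leaves \<open>e * (y \<bullet> x) = 0\<close>; as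
  \<open>e > 0\<close>, this reduces the kernel equation to
  \<open>(1 + e) *\<^sub>R x = 0\<close>.\<close>

lemma spd_perp_proj_reg_conj:
  assumes H: "spd H" and e: "e > 0"
  shows "spd (perp_proj_reg e y ** H ** perp_proj_reg e y)"
  unfolding spd_def
proof (intro conjI allI impI)
  show "transpose (perp_proj_reg e y ** H ** perp_proj_reg e y) =
      perp_proj_reg e y ** H ** perp_proj_reg e y"
    using H by (simp add: spd_def matrix_transpose_mul transpose_perp_proj_reg matrix_mul_assoc)
  fix x :: "real ^ 'a" assume "x \<noteq> 0"
  have "perp_proj_reg e y *v x \<noteq> 0"
  proof
    assume "perp_proj_reg e y *v x = 0"
    then have *: "(1 + e) *\<^sub>R x = ((y \<bullet> x) / (y \<bullet> y)) *\<^sub>R y"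
      by (simp add: perp_proj_reg_mult_vec)
    then have "y \<bullet> ((1 + e) *\<^sub>R x) = y \<bullet> (((y \<bullet> x) / (y \<bullet> y)) *\<^sub>R y)" by simp
    then have "y \<bullet> x = 0 \<or> y \<bullet> y = 0" using e by (auto simp: algebra_simps)
    with * have "(1 + e) *\<^sub>R x = 0" by auto
    with e \<open>x \<noteq> 0\<close> show False by simp
  qed
  then have "0 < (perp_proj_reg e y *v x) \<bullet> (H *v (perp_proj_reg e y *v x))"
    using H by (simp add: spd_def)
  then show "0 < x \<bullet> ((perp_proj_reg e y ** H ** perp_proj_reg e y) *v x)"
    by (metis inner_transpose_mult matrix_vector_mul_assoc transpose_perp_proj_reg)
qed

lemma regularized_minimizer_iff:
  fixes Bk :: "real ^ 'n ^ 'n"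
  assumes Bk: "spd Bk" and ys: "y \<bullet> s > 0" and e: "e > 0"
  shows "regularized_minimizer e Bk y s B \<longleftrightarrow>
    B = matrix_inv (secant_update e (matrix_inv Bk) y s)"
proof -
  define H where "H = secant_update e (matrix_inv Bk) y s"
  define Y where "Y = perp_proj_reg e y ** matrix_inv Bk ** perp_proj_reg e y"
  define f where "f B = rel_entropy (matrix_inv B) Y" for B
  have Hk: "spd (matrix_inv Bk)" using Bk by (rule spd_matrix_inv)
  have H: "spd H" unfolding H_def using e by (intro spd_secant_update Hk ys) simp
  have Y: "spd Y" unfolding Y_def by (rule spd_perp_proj_reg_conj[OF Hk e])
  obtain l where l: "Y = H + (outer l s + outer s l)"
    using perp_proj_reg_conj_eq[OF _ ys, of "matrix_inv Bk" e] Hk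
    unfolding Y_def H_def spd_def by blast
  \<comment> \<open>The part of the objective that is constant on the feasible set; it turns out to
    be the minimum value.\<close>
  define c where "c = (2 * (l \<bullet> y) + ln (det H) - ln (det Y)) / 2"
  have f: "f B = (trace (H ** B) - real CARD('n) - ln (det (H ** B))) / 2 + c"
    if "feasible y s B" for B
  proof -
    have B: "spd B" "matrix_inv B *v y = s" using that by (auto simp: feasible_def)
    then have "B *v s = y"
      by (metis matrix_vector_mul_assoc matrix_vector_mul_lid spd_matrix_inv(1))
    then have "trace (Y ** B) = trace (H ** B) + 2 * (l \<bullet> y)"
      using B(1) unfolding l
      by (simp add: matrix_add_rdistrib[of H] trace_add trace_multiplier_term spd_def)
    then show ?thesis
      by (simp add: f_def rel_entropy_eq[OF H Y B(1)] c_def field_simps)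
  qed
  have inv: "H ** matrix_inv H = mat 1" "matrix_inv (matrix_inv H) = H"
    using spd_matrix_inv[OF H] by auto
  have feas: "feasible y s (matrix_inv H)"
    using spd_matrix_inv(4)[OF H] secant_update_mult_y[OF ys]
    by (simp add: feasible_def inv) (simp add: H_def)
  have fH: "f (matrix_inv H) = c" by (simp add: f[OF feas] inv trace_I)
  have ge: "c \<le> f B" if "feasible y s B" for B
    using ln_det_spd_mult(2)[OF H, of B] that by (simp add: f feasible_def)
  have "B = matrix_inv H" if "feasible y s B" "f B = c" for B
  proof -
    have "H ** B = mat 1"
      using ln_det_spd_mult(3)[OF H, of B] that by (simp add: f feasible_def)
    then show ?thesis using matrix_inv_unique by metis
  qed
  then have "is_arg_min f (feasible y s) B \<longleftrightarrow> B = matrix_inv H"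
    unfolding is_arg_min_linorder using feas fH ge by (metis order_antisym)
  then show ?thesis
    unfolding regularized_minimizer_def f_def[abs_def] Y_def H_def .
qed

section \<open>Passage to the limit\<close>

lemma tendsto_matrix_mult:
  fixes f :: "'a \<Rightarrow> real ^ 'n ^ 'm" and g :: "'a \<Rightarrow> real ^ 'k ^ 'n"
  assumes "(f \<longlongrightarrow> A) F" "(g \<longlongrightarrow> B) F"
  shows "((\<lambda>x. f x ** g x) \<longlongrightarrow> A ** B) F"
  unfolding matrix_matrix_mult_def
  by (intro vec_tendstoI) (auto intro!: tendsto_intros assms)

lemma tendsto_transpose:
  fixes f :: "'a \<Rightarrow> real ^ 'n ^ 'm"
  assumes "(f \<longlongrightarrow> A) F"
  shows "((\<lambda>x. transpose (f x)) \<longlongrightarrow> transpose A) F"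
  unfolding transpose_def
  by (intro vec_tendstoI) (auto intro!: tendsto_intros assms)

lemma tendsto_secant_update:
  "((\<lambda>e. secant_update e H y s) \<longlongrightarrow> secant_update 0 H y s) (at_right 0)"
proof -
  have "((\<lambda>e. update_root e y s) \<longlongrightarrow> update_root 0 y s) (at_right 0)"
    \<comment> \<open>Writing the quotient as a product with a constant avoids the side condition
      \<open>y \<bullet> s \<noteq> 0\<close> of the quotient rule.\<close>
    unfolding update_root_def perp_proj_reg_def divide_inverse by (intro tendsto_intros)
  then show ?thesis
    unfolding secant_update_def
    by (intro tendsto_add tendsto_const tendsto_matrix_mult tendsto_transpose)
qed

lemma secant_update_0:
  "secant_update 0 H y s = perp_proj y ** H ** perp_proj y + (1 / (y \<bullet> s)) *\<^sub>R outer s s"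
  using transpose_perp_proj_reg[of 0 y]
  by (simp add: secant_update_def update_root_def perp_proj_reg_def)

theorem theorem2p2:
  fixes Bk :: "real ^ 'n ^ 'n" and y s :: "real ^ 'n"
  assumes "spd Bk" and "y \<bullet> s > 0"
  shows "\<exists>Bstar. spd Bstar \<and>
           matrix_inv Bstar =
             (mat 1 - (1 / (y \<bullet> y)) *\<^sub>R outer y y) ** matrix_inv Bk **
             (mat 1 - (1 / (y \<bullet> y)) *\<^sub>R outer y y) + (1 / (y \<bullet> s)) *\<^sub>R outer s s \<and>
           (\<forall>B. regularized_solution Bk y s B \<longleftrightarrow> B = Bstar)"
proof -
  define H where "H e = secant_update e (matrix_inv Bk) y s" for e
  have H: "spd (H e)" if "e \<ge> 0" for e
    unfolding H_def by (intro spd_secant_update spd_matrix_inv(4) assms that)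
  have inv: "spd (matrix_inv (H e))" "matrix_inv (matrix_inv (H e)) = H e" if "e \<ge> 0" for e
    using spd_matrix_inv[OF H[OF that]] by auto
  have min: "regularized_minimizer e Bk y s B \<longleftrightarrow> B = matrix_inv (H e)" if "e > 0" for e B
    unfolding H_def by (rule regularized_minimizer_iff[OF assms that])
  have lim: "(H \<longlongrightarrow> H 0) (at_right 0)"
    unfolding H_def by (rule tendsto_secant_update)
  have "regularized_solution Bk y s B \<longleftrightarrow> B = matrix_inv (H 0)" for B
  proof
    assume "regularized_solution Bk y s B"
    then obtain Br where B: "spd B" and Br: "\<forall>e>0. regularized_minimizer e Bk y s (Br e)"
      and tends: "((\<lambda>e. matrix_inv (Br e)) \<longlongrightarrow> matrix_inv B) (at_right 0)"
      by (auto simp: regularized_solution_def feasible_def)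
    \<comment> \<open>Uniqueness of each regularized minimizer leaves no freedom in
      \<open>Br\<close> for positive \<open>e\<close>, so its inverses share the limit of
      \<open>H\<close>.\<close>
    have "\<forall>\<^sub>F e in at_right 0. matrix_inv (Br e) = H e"
      using Br min inv by (auto simp: eventually_at_filter)
    then have "(H \<longlongrightarrow> matrix_inv B) (at_right 0)"
      using tends by (rule Lim_transform_eventually[rotated])
    then have "matrix_inv B = H 0"
      using lim by (intro tendsto_unique[of "at_right 0"]) auto
    then show "B = matrix_inv (H 0)" using spd_matrix_inv(3)[OF B] by simp
  next
    assume B: "B = matrix_inv (H 0)"
    \<comment> \<open>The double inverse is known to cancel only for \<open>e \<ge> 0\<close>, hence
      the passage through eventual equality.\<close>
    have "\<forall>\<^sub>F e in at_right 0. H e = matrix_inv (matrix_inv (H e))"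
      using inv by (auto simp: eventually_at_filter)
    then have "((\<lambda>e. matrix_inv (matrix_inv (H e))) \<longlongrightarrow> matrix_inv B) (at_right 0)"
      using lim unfolding B inv(2)[OF order_refl] by (rule Lim_transform_eventually[rotated])
    moreover have "feasible y s B"
      using inv[of 0] secant_update_mult_y[OF assms(2)] by (simp add: feasible_def B) (simp add: H_def)
    ultimately show "regularized_solution Bk y s B"
      unfolding regularized_solution_def
      by (intro conjI exI[of _ "\<lambda>e. matrix_inv (H e)"]) (auto simp: min)
  qed
  moreover have "matrix_inv (matrix_inv (H 0)) =
      perp_proj y ** matrix_inv Bk ** perp_proj y + (1 / (y \<bullet> s)) *\<^sub>R outer s s"
    using inv[of 0] by (simp add: H_def secant_update_0)
  ultimately show ?thesis
    using inv(1)[of 0] unfolding perp_proj_def by auto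
qed

end
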